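(* Let $G$ be a connected graph of order $n$. If $\sigma_2(G)\ge n-k+1$ for some positive integer $k$, then $G$ has a spanning tree $T$ such that $\sum_{v\in B(T)} d_T(v)\le \frac{3}{2}(k-1)$, where $B(T)$ is the set of branch vertices of $T$.
   Context: All graphs are finite, undirected, without loops or multiple edges. For a graph $G$, $\sigma_2(G)$ denotes the minimum of $d_G(u)+d_G(v)$ over all pairs of distinct nonadjacent vertices $u,v$ of $G$; if $G$ has no two nonadjacent vertices (i.e. $G$ is complete), $\sigma_2(G)=+\infty$. A branch vertex of a tree $T$ is a vertex of degree at least three in $T$; $B(T)$ denotes the set of branch vertices of $T$, and $d_T(v)$ the degree of $v$ in $T$ (the sum over an empty set is $0$). *)

theory Defs
  imports "Graph_Theory.Graph_Theory" "HOL-Library.Extended_Real"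
begin

text \<open>
  A finite simple graph is a \<^locale>\<open>pair_graph\<close>: a finite vertex set with a symmetric, irreflexive
  arc relation, each edge being represented by its two orientations. Hence the degree of a vertex
  is its \<^const>\<open>out_degree\<close>.
\<close>

text \<open>
  The set below is finite, so the infimum is a minimum unless the graph is complete, in which case
  it is \<^term>\<open>\<infinity> :: ereal\<close>.
\<close>

definition sigma2 :: "'a pair_pre_digraph \<Rightarrow> ereal" where
  "sigma2 G = Inf {ereal (real (out_degree G u + out_degree G v)) | u v.
     u \<in> pverts G \<and> v \<in> pverts G \<and> u \<noteq> v \<and> (u, v) \<notin> parcs G}"

text \<open>
  The library's \<^const>\<open>tree\<close> and \<^const>\<open>spanning_tree\<close> forbid directed cycles, including
  those of length 2 that run back and forth along one edge, so no symmetric digraph with an edge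
  is a \<^const>\<open>tree\<close>. The cycles of an undirected simple graph are the directed ones of length at
  least 3.
\<close>

definition undirected_tree :: "'a pair_pre_digraph \<Rightarrow> bool" where
  "undirected_tree T \<longleftrightarrow> pair_graph T \<and> Digraph_Component.connected T \<and>
     \<not> (\<exists>p. pre_digraph.cycle T p \<and> 3 \<le> length p)"

definition undirected_spanning_tree :: "'a pair_pre_digraph \<Rightarrow> 'a pair_pre_digraph \<Rightarrow> bool" where
  "undirected_spanning_tree T G \<longleftrightarrow> undirected_tree T \<and> spanning T G"

definition branch_vertices :: "'a pair_pre_digraph \<Rightarrow> 'a set" where
  "branch_vertices T = {v \<in> pverts T. 3 \<le> out_degree T v}"

end

theory Submission
  imports Defs
begin

text \<open>
  Let \<open>T\<close> be a spanning tree of minimum total branch degree, with \<open>L\<close> its leaves and \<open>B\<close> its branch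
  vertices, and suppose \<open>B \<noteq> {}\<close>. Edge exchanges show that the leaves are independent in \<open>G\<close> and that,
  for a leaf \<open>x\<close>, the map sending \<open>y \<in> N(x)\<close> to the next vertex on the path in \<open>T\<close> from \<open>y\<close> to \<open>x\<close> is
  injective, avoids \<open>B\<close> and all leaves other than \<open>x\<close>, and avoids \<open>N(z)\<close> for every other leaf \<open>z\<close>.

  Among all such \<open>T\<close> and all tree edges \<open>cb\<close> with \<open>b \<in> B\<close>, choose one for which the component of \<open>b\<close> in
  \<open>T - cb\<close> is smallest. Then that component consists of \<open>b\<close> and pendant paths. If the leaf \<open>z\<close> of such a path
  had a neighbour \<open>y \<in> B - {b}\<close> in \<open>G\<close>, re-hanging the path at \<open>y\<close> would lower the total branch degree
  (if \<open>b\<close> has degree 3) or keep it and shrink the component; hence \<open>N(z) \<inter> B \<subseteq> {b}\<close>. Counting gives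
  \<open>d(x) + d(z) \<le> n - (|L| - 1) - (|B| - 1)\<close>, and the theorem follows since the total branch degree
  equals \<open>|L| - 2 + 2|B|\<close> and is at least \<open>3|B|\<close>.
\<close>

subsection \<open>Trees as symmetric arc sets\<close>

locale conn_graph =
  fixes V :: "'a set" and E :: "('a \<times> 'a) set"
  assumes finite_V: "finite V"
    and V_nonempty: "V \<noteq> {}"
    and E_subset: "E \<subseteq> V \<times> V"
    and sym_E: "sym E"
    and irrefl_E: "irrefl E"
    and connected_E: "u \<in> V \<Longrightarrow> v \<in> V \<Longrightarrow> (u, v) \<in> E\<^sup>*"
begin

lemma finite_E: "finite E"
  using E_subset finite_V finite_subset by blast

lemma arcD: "(u, v) \<in> E \<Longrightarrow> u \<in> V \<and> v \<in> V \<and> u \<noteq> v \<and> (v, u) \<in> E"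
  using E_subset irrefl_E symD[OF sym_E, of u v] by (auto simp: irrefl_def)

end

text \<open>Each of the \<open>card V - 1\<close> edges of a tree contributes two arcs.\<close>

locale arc_tree = conn_graph V T for V :: "'a set" and T :: "('a \<times> 'a) set" +
  assumes card_T: "card T + 2 = 2 * card V"

text \<open>Breadth-first search: every vertex other than the root \<open>r\<close> is joined to a
  parent strictly closer to \<open>r\<close>. The \<open>card V - 1\<close> parent arcs and their
  reversals form the tree.\<close>

lemma (in conn_graph) ex_spanning_arc_tree: "\<exists>T\<subseteq>E. arc_tree V T"
proof -
  obtain r where r: "r \<in> V" using V_nonempty by blast
  define dist where "dist v = (LEAST m. (r, v) \<in> E ^^ m)" for v
  have dist: "(r, v) \<in> E ^^ dist v" if "v \<in> V" for v
    unfolding dist_def using connected_E[OF r that] by (metis LeastI rtrancl_imp_relpow)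
  have "\<exists>p. (p, v) \<in> E \<and> dist p < dist v" if "v \<in> V - {r}" for v
  proof -
    have d: "(r, v) \<in> E ^^ dist v" using dist that by blast
    have "dist v \<noteq> 0" using d that by (metis Diff_iff insertI1 relpow_0_E)
    then obtain m where m: "dist v = Suc m" by (cases "dist v") auto
    then obtain p where p: "(r, p) \<in> E ^^ m" "(p, v) \<in> E" using d by auto
    have "dist p \<le> m" unfolding dist_def using p(1) by (rule Least_le)
    then show ?thesis using p m by auto
  qed
  then obtain par where par: "\<And>v. v \<in> V - {r} \<Longrightarrow> (par v, v) \<in> E \<and> dist (par v) < dist v"
    by metis
  define A where "A = (\<lambda>v. (par v, v)) ` (V - {r})"
  define B where "B = (\<lambda>v. (v, par v)) ` (V - {r})"
  have "card A = card V - 1" "card B = card V - 1"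
    unfolding A_def B_def using r finite_V by (subst card_image; auto simp: inj_on_def)+
  \<comment> \<open>An arc in both sets would make two vertices parents of each other, and
    \<open>dist\<close> would decrease both ways.\<close>
  moreover have "A \<inter> B = {}"
  proof -
    have False if "v \<in> V - {r}" "w \<in> V - {r}" "par v = w" "v = par w" for v w
      using par[OF that(1)] par[OF that(2)] that(3,4) by simp
    then show ?thesis unfolding A_def B_def by blast
  qed
  moreover have "finite A" "finite B" unfolding A_def B_def using finite_V by auto
  moreover have "card V \<ge> 1" using r finite_V by (metis One_nat_def Suc_leI card_gt_0_iff empty_iff)
  ultimately have c: "card (A \<union> B) + 2 = 2 * card V" by (simp add: card_Un_disjoint)
  have AE: "A \<union> B \<subseteq> E" unfolding A_def B_def using par arcD by blast
  have s: "sym (A \<union> B)" unfolding A_def B_def by (auto simp: sym_def)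
  have reach: "(r, v) \<in> (A \<union> B)\<^sup>*" if "v \<in> V" for v
    using that
  proof (induction "dist v" arbitrary: v rule: less_induct)
    case less
    show ?case
    proof (cases "v = r")
      case False
      then have "(r, par v) \<in> (A \<union> B)\<^sup>*" using less par arcD by blast
      moreover have "(par v, v) \<in> A \<union> B" unfolding A_def using less.prems False by blast
      ultimately show ?thesis by (rule rtrancl_into_rtrancl)
    qed simp
  qed
  have "arc_tree V (A \<union> B)"
  proof
    show "irrefl (A \<union> B)" using AE irrefl_E by (auto simp: irrefl_def)
    fix u v assume "u \<in> V" "v \<in> V"
    then have "(u, r) \<in> (A \<union> B)\<^sup>*" "(r, v) \<in> (A \<union> B)\<^sup>*"
      using reach symD[OF sym_rtrancl[OF s]] by blast+
    then show "(u, v) \<in> (A \<union> B)\<^sup>*" by simp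
  qed (use finite_V V_nonempty AE E_subset s c in auto)
  then show ?thesis using AE by blast
qed

text \<open>This bound makes arc-minimality available: a tree that loses an edge has too few arcs to
  stay connected.\<close>

lemma (in conn_graph) card_arcs_ge: "2 * card V \<le> card E + 2"
proof -
  obtain T where "T \<subseteq> E" "arc_tree V T" using ex_spanning_arc_tree by blast
  then show ?thesis using card_mono[OF finite_E, of T] arc_tree.card_T[of V T] by linarith
qed

text \<open>For a tree edge \<open>ab\<close> this is the component of \<open>T - ab\<close> that
  contains the second argument \<open>b\<close>.\<close>

definition side :: "('a \<times> 'a) set \<Rightarrow> 'a \<Rightarrow> 'a \<Rightarrow> 'a set" where
  "side T a b = {v. (b, v) \<in> (T - {(a, b), (b, a)})\<^sup>*}"

text \<open>The edge \<open>ab\<close> is traded for \<open>cd\<close>. The result is again a tree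
  when \<open>c\<close> lies on the side of \<open>b\<close> and \<open>d\<close> on the side of
  \<open>a\<close>.\<close>

definition exchange :: "('a \<times> 'a) set \<Rightarrow> 'a \<Rightarrow> 'a \<Rightarrow> 'a \<Rightarrow> 'a \<Rightarrow> ('a \<times> 'a) set" where
  "exchange T a b c d = T - {(a, b), (b, a)} \<union> {(c, d), (d, c)}"

definition degree :: "('a \<times> 'a) set \<Rightarrow> 'a \<Rightarrow> nat" where
  "degree T v = card {u. (v, u) \<in> T}"

text \<open>With a weight for every degree, the total becomes a sum over the fixed set
  \<open>V\<close>, so two trees can be compared vertex by vertex although their branch vertices
  differ.\<close>

definition branch_weight :: "nat \<Rightarrow> nat" where
  "branch_weight d = (if 3 \<le> d then d else 0)"

definition total_branch_degree :: "'a set \<Rightarrow> ('a \<times> 'a) set \<Rightarrow> nat" where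
  "total_branch_degree V T = (\<Sum>v\<in>V. branch_weight (degree T v))"

lemma side_self: "b \<in> side T a b"
  by (simp add: side_def)

lemma side_step:
  assumes "u \<in> side T a b" "(u, v) \<in> T" "(u, v) \<noteq> (a, b)" "(u, v) \<noteq> (b, a)"
  shows "v \<in> side T a b"
  using assms unfolding side_def by (auto intro: rtrancl_into_rtrancl)

lemma side_subsetI:
  assumes "b \<in> S"
    and "\<And>u v. u \<in> S \<Longrightarrow> u \<in> side T a b \<Longrightarrow> (u, v) \<in> T \<Longrightarrow> (u, v) \<noteq> (a, b) \<Longrightarrow> (u, v) \<noteq> (b, a) \<Longrightarrow> v \<in> S"
  shows "side T a b \<subseteq> S"
proof
  fix v assume "v \<in> side T a b"
  then have "(b, v) \<in> (T - {(a, b), (b, a)})\<^sup>*" by (simp add: side_def)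
  then show "v \<in> S"
  proof (induction rule: rtrancl_induct)
    case (step u v)
    then show ?case using assms(2)[of u v] by (simp add: side_def)
  qed (rule assms(1))
qed

context conn_graph
begin

lemma finite_nbrs: "finite {u. (v, u) \<in> E}"
  by (rule finite_subset[OF _ finite_V]) (use arcD in auto)

lemma sum_degree: "(\<Sum>v\<in>V. degree E v) = card E"
proof -
  have "E = Sigma V (\<lambda>v. {u. (v, u) \<in> E})" using arcD by auto
  then have "card E = card (Sigma V (\<lambda>v. {u. (v, u) \<in> E}))" by simp
  also have "\<dots> = (\<Sum>v\<in>V. card {u. (v, u) \<in> E})"
    by (rule card_SigmaI) (use finite_V finite_nbrs in auto)
  finally show ?thesis by (simp add: degree_def)
qed

lemma degree_pos:
  assumes "v \<in> V" "u \<in> V" "u \<noteq> v"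
  shows "0 < degree E v"
proof -
  have "(v, u) \<in> E\<^sup>*" using assms connected_E by blast
  then obtain w where "(v, w) \<in> E" using assms(3) by (metis converse_rtranclE)
  then show ?thesis unfolding degree_def using finite_nbrs[of v] by (auto simp: card_gt_0_iff)
qed

end

section \<open>The two sides of a tree edge\<close>

context arc_tree
begin

text \<open>If \<open>a\<close> still reached \<open>b\<close> without the edge \<open>ab\<close>,
  deleting that edge would leave a connected graph violating \<open>card_arcs_ge\<close>.\<close>

lemma bridge:
  assumes ab: "(a, b) \<in> T"
  shows "(a, b) \<notin> (T - {(a, b), (b, a)})\<^sup>*"
proof
  let ?D = "T - {(a, b), (b, a)}"
  assume r: "(a, b) \<in> ?D\<^sup>*"
  have s: "sym ?D" using sym_E by (auto simp: sym_def)
  have "(b, a) \<in> ?D\<^sup>*" using r s by (metis symD sym_rtrancl)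
  then have "T \<subseteq> ?D\<^sup>*" using r by auto
  then have *: "T\<^sup>* \<subseteq> ?D\<^sup>*" by (metis rtrancl_idemp rtrancl_mono)
  interpret D: conn_graph V ?D
  proof
    show "irrefl ?D" using irrefl_E by (auto simp: irrefl_def)
    show "(u, v) \<in> ?D\<^sup>*" if "u \<in> V" "v \<in> V" for u v using connected_E[OF that] * by blast
  qed (use finite_V V_nonempty E_subset s in auto)
  have "card ?D < card T" using ab finite_E by (intro psubset_card_mono) auto
  then show False using D.card_arcs_ge card_T by linarith
qed

lemma side_notin: "(a, b) \<in> T \<Longrightarrow> a \<notin> side T a b"
  using bridge[of b a] arcD[of a b] by (auto simp: side_def insert_commute)

lemma side_subset_V: "(a, b) \<in> T \<Longrightarrow> side T a b \<subseteq> V"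
  by (rule side_subsetI) (use arcD in auto)

lemma finite_side: "(a, b) \<in> T \<Longrightarrow> finite (side T a b)"
  using side_subset_V finite_V finite_subset by blast

lemma side_disjoint:
  assumes "(a, b) \<in> T"
  shows "side T a b \<inter> side T b a = {}"
proof -
  have s: "sym ((T - {(a, b), (b, a)})\<^sup>*)" using sym_E by (intro sym_rtrancl) (auto simp: sym_def)
  have False if "(b, v) \<in> (T - {(a, b), (b, a)})\<^sup>*" "(a, v) \<in> (T - {(a, b), (b, a)})\<^sup>*" for v
  proof -
    have "(a, b) \<in> (T - {(a, b), (b, a)})\<^sup>*" using that symD[OF s that(1)] by simp
    then show False using bridge[OF assms] by blast
  qed
  then show ?thesis by (auto simp: side_def insert_commute)
qed

lemma side_union:
  assumes "(a, b) \<in> T"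
  shows "side T a b \<union> side T b a = V"
proof
  show "side T a b \<union> side T b a \<subseteq> V" using side_subset_V assms arcD by blast
  show "V \<subseteq> side T a b \<union> side T b a"
  proof
    fix v assume "v \<in> V"
    then have "(a, v) \<in> T\<^sup>*" using connected_E arcD assms by blast
    then show "v \<in> side T a b \<union> side T b a"
    proof (induction rule: rtrancl_induct)
      case base
      then show ?case by (simp add: side_self)
    next
      case (step u v)
      then show ?case using side_step[of u T a b v] side_step[of u T b a v] side_self[of a T b] side_self[of b T a]
        by auto
    qed
  qed
qed

lemma side_compl: "(a, b) \<in> T \<Longrightarrow> side T b a = V - side T a b"
  using side_union[of a b] side_disjoint[of a b] by blast

text \<open>A walk that starts at \<open>w\<close> can leave \<open>side T b c\<close> only across
  the edge \<open>bc\<close>, and then it visits both \<open>b\<close> and \<open>c\<close>.\<close>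

lemma side_mono:
  assumes "w \<in> side T b c" "\<not> (b \<in> side T q w \<and> c \<in> side T q w)"
  shows "side T q w \<subseteq> side T b c"
proof -
  show ?thesis
  proof (rule side_subsetI[OF assms(1)])
    fix u v assume *: "u \<in> side T b c" "u \<in> side T q w" "(u, v) \<in> T" "(u, v) \<noteq> (q, w)" "(u, v) \<noteq> (w, q)"
    then have "v \<in> side T q w" by (auto intro: side_step)
    then show "v \<in> side T b c" using * assms(2) by (intro side_step[of u T b c v]) auto
  qed
qed

text \<open>Moving one step further from \<open>q\<close> loses at least the vertex
  \<open>b\<close>. This strict decrease drives the inductions on the size of a side.\<close>

lemma side_nbr_psubset:
  assumes "(b, r) \<in> T" "(b, q) \<in> T" "r \<noteq> q"
  shows "side T b r \<subset> side T q b"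
proof -
  have q: "q \<notin> side T b r"
  proof
    assume "q \<in> side T b r"
    then have "b \<in> side T b r" by (rule side_step) (use assms arcD in auto)
    then show False using side_notin assms by blast
  qed
  have "r \<in> side T q b" by (rule side_step[OF side_self]) (use assms arcD in auto)
  then have "side T b r \<subseteq> side T q b" using q by (intro side_mono) auto
  then show ?thesis using side_self[of b T q] side_notin[OF assms(1)] by blast
qed

lemma ex_side:
  assumes "w \<in> V" "x \<in> V" "w \<noteq> x"
  obtains q where "(w, q) \<in> T" "x \<in> side T w q"
proof -
  have "(w, x) \<in> T\<^sup>*" using connected_E assms by blast
  then have "x = w \<or> (\<exists>q. (w, q) \<in> T \<and> x \<in> side T w q)"
  proof (induction rule: rtrancl_induct)
    case (step u v)
    then show ?case using side_self[of v T w] side_step[of u T w _ v] by blast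
  qed simp
  then show ?thesis using that assms by blast
qed

end

text \<open>The additive form avoids subtraction on naturals. It serves both a tree and its
  exchange, which share the same remainder once an edge is removed.\<close>

lemma degree_remove_edge:
  assumes "(a, b) \<in> R" "(b, a) \<in> R" "a \<noteq> b" "finite {u. (v, u) \<in> R}"
  shows "degree R v = degree (R - {(a, b), (b, a)}) v + (if v = a \<or> v = b then 1 else 0)"
proof -
  let ?N = "\<lambda>R. {u. (v, u) \<in> R}" and ?D = "R - {(a, b), (b, a)}"
  have fin: "finite (?N ?D)" by (rule finite_subset[OF _ assms(4)]) auto
  consider "v = a" | "v = b" | "v \<noteq> a" "v \<noteq> b" by blast
  then show ?thesis
  proof cases
    case 1
    then have "?N R = insert b (?N ?D)" "b \<notin> ?N ?D" using assms by auto
    then show ?thesis using 1 fin by (simp add: degree_def)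
  next
    case 2
    then have "?N R = insert a (?N ?D)" "a \<notin> ?N ?D" using assms by auto
    then show ?thesis using 2 fin by (simp add: degree_def)
  next
    case 3
    then have "?N R = ?N ?D" by auto
    then show ?thesis using 3 by (simp add: degree_def)
  qed
qed

text \<open>The next vertex on the path from \<open>y\<close> to \<open>x\<close>; unspecified for \<open>y = x\<close>.\<close>

definition toward :: "('a \<times> 'a) set \<Rightarrow> 'a \<Rightarrow> 'a \<Rightarrow> 'a" where
  "toward T x y = (SOME q. (y, q) \<in> T \<and> x \<in> side T y q)"

section \<open>Edge exchanges, leaves, and paths toward a leaf\<close>

context arc_tree
begin

text \<open>Deleting \<open>ab\<close> leaves two components that \<open>cd\<close> joins again,
  with the number of arcs unchanged. The degree formula also covers the case that the two edges
  share endpoints.\<close>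

lemma
  assumes ab: "(a, b) \<in> T" and c: "c \<in> side T a b" and d: "d \<in> side T b a"
  shows arc_tree_exchange: "arc_tree V (exchange T a b c d)"
    and degree_exchange: "degree (exchange T a b c d) v + (if v = a \<or> v = b then 1 else 0)
       = degree T v + (if v = c \<or> v = d then 1 else 0)"
proof -
  let ?D = "T - {(a, b), (b, a)}" and ?X = "exchange T a b c d"
  have ba: "(b, a) \<in> T" "a \<noteq> b" using arcD ab by auto
  have cd: "c \<noteq> d" using c d side_disjoint[OF ab] by blast
  have cV: "c \<in> V" "d \<in> V" using side_subset_V ab ba c d by auto
  \<comment> \<open>An arc between \<open>c\<close> and \<open>d\<close> surviving in
    \<open>?D\<close> would connect the two disjoint sides.\<close>
  have nD: "(c, d) \<notin> ?D" "(d, c) \<notin> ?D"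
    using side_step[OF c, of d] side_step[OF d, of c] c d side_disjoint[OF ab] by blast+
  have D: "?X - {(c, d), (d, c)} = ?D" unfolding exchange_def using nD by blast
  have sD: "sym ?D" using sym_E by (auto simp: sym_def)
  have sX: "sym ?X" unfolding exchange_def using sym_E by (auto simp: sym_def)
  have irr: "irrefl ?X" unfolding exchange_def using irrefl_E cd by (auto simp: irrefl_def)
  have DX: "?D\<^sup>* \<subseteq> ?X\<^sup>*" unfolding exchange_def by (rule rtrancl_mono) blast
  have "(b, c) \<in> ?D\<^sup>*" using c by (simp add: side_def)
  then have bc: "(b, c) \<in> ?X\<^sup>*" using DX by blast
  have "(a, d) \<in> ?D\<^sup>*" using d by (simp add: side_def insert_commute)
  then have "(d, a) \<in> ?X\<^sup>*" using DX symD[OF sym_rtrancl[OF sD]] by blast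
  moreover have "(c, d) \<in> ?X" by (simp add: exchange_def)
  ultimately have bX: "(b, a) \<in> ?X\<^sup>*" using bc by (meson rtrancl.rtrancl_into_rtrancl rtrancl_trans)
  then have aX: "(a, b) \<in> ?X\<^sup>*" using symD[OF sym_rtrancl[OF sX]] by blast
  \<comment> \<open>Only the deleted edge needs a detour, which runs from \<open>b\<close> to
    \<open>c\<close>, over the new edge to \<open>d\<close>, and on to \<open>a\<close>.\<close>
  have "T \<subseteq> ?X\<^sup>*" using aX bX unfolding exchange_def by auto
  then have TX: "T\<^sup>* \<subseteq> ?X\<^sup>*" by (metis rtrancl_idemp rtrancl_mono)
  have finD: "finite ?D" using finite_E by blast
  have "card ?D + 2 = card T"
  proof -
    have "card ?D = card T - card {(a, b), (b, a)}" using ab ba by (intro card_Diff_subset) auto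
    moreover have "card {(a, b), (b, a)} \<le> card T" using ab ba finite_E by (intro card_mono) auto
    ultimately show ?thesis using ba(2) by simp
  qed
  moreover have "card ?X = card ?D + card {(c, d), (d, c)}"
    unfolding exchange_def using nD finD by (intro card_Un_disjoint) auto
  ultimately have "card ?X = card T" using cd by simp
  then show X: "arc_tree V ?X"
    using finite_V V_nonempty sX irr TX connected_E card_T cV E_subset
    by unfold_locales (auto simp: exchange_def)
  interpret X: arc_tree V ?X by fact
  have "degree T v = degree ?D v + (if v = a \<or> v = b then 1 else 0)"
    by (rule degree_remove_edge) (use ab ba finite_nbrs in auto)
  moreover have "degree ?X v = degree (?X - {(c, d), (d, c)}) v + (if v = c \<or> v = d then 1 else 0)"
    by (rule degree_remove_edge) (use cd X.finite_nbrs in \<open>auto simp: exchange_def\<close>)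
  ultimately show "degree ?X v + (if v = a \<or> v = b then 1 else 0)
       = degree T v + (if v = c \<or> v = d then 1 else 0)" unfolding D by simp
qed

lemma degree_ge_card:
  assumes "\<And>u. u \<in> S \<Longrightarrow> (v, u) \<in> T"
  shows "card S \<le> degree T v"
  unfolding degree_def using finite_nbrs assms by (intro card_mono) auto

lemma leaf_nbr_unique:
  assumes "degree T x = 1" "(x, u) \<in> T" "(x, w) \<in> T"
  shows "u = w"
  using degree_ge_card[of "{u, w}" x] assms by (cases "u = w") auto

lemma side_leaf:
  assumes "degree T x = 1" "(b, x) \<in> T"
  shows "side T b x = {x}"
proof -
  have "(x, b) \<in> T" using assms arcD by blast
  then have "side T b x \<subseteq> {x}"
    using leaf_nbr_unique[OF assms(1)] by (intro side_subsetI) auto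
  then show ?thesis using side_self[of x T b] by blast
qed

lemma ex_other_nbr:
  assumes "(c, b) \<in> T" "degree T c \<noteq> 1"
  obtains r where "(c, r) \<in> T" "r \<noteq> b"
proof -
  have "{u. (c, u) \<in> T} \<noteq> {b}" using assms(2) by (auto simp: degree_def)
  then show ?thesis using assms(1) that by blast
qed

lemma side_unique:
  assumes "(y, q) \<in> T" "(y, r) \<in> T" "x \<in> side T y q" "x \<in> side T y r"
  shows "q = r"
proof (rule ccontr)
  assume "q \<noteq> r"
  then have "x \<in> side T r y" using side_nbr_psubset[of y q r] assms by blast
  then show False using side_disjoint[OF assms(2)] assms(4) by blast
qed

text \<open>Walk away from \<open>b\<close>: while the current vertex is not a leaf there is a
  further neighbour, and the side behind it is strictly smaller.\<close>

lemma ex_leaf_in_side: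
  "(b, c) \<in> T \<Longrightarrow> \<exists>z\<in>side T b c. degree T z = 1"
proof (induction "card (side T b c)" arbitrary: b c rule: less_induct)
  case less
  show ?case
  proof (cases "degree T c = 1")
    case True
    then show ?thesis using side_self[of c T b] by blast
  next
    case False
    have cb: "(c, b) \<in> T" using less.prems arcD by blast
    then obtain r where r: "(c, r) \<in> T" "r \<noteq> b" using False by (rule ex_other_nbr)
    have sub: "side T c r \<subset> side T b c" using side_nbr_psubset r cb by blast
    then have "card (side T c r) < card (side T b c)"
      using finite_side[OF less.prems] by (rule psubset_card_mono[rotated])
    then show ?thesis using less.hyps[OF _ r(1)] sub by blast
  qed
qed

text \<open>Follow the paths to \<open>x\<close> and \<open>z\<close> while they agree. Where they
  part, the current vertex has the two diverging neighbours and the one it was reached from, so it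
  is a branch vertex.\<close>

lemma branch_separates_in_side:
  assumes "degree T x = 1" "degree T z = 1" "x \<noteq> z"
  shows "(b, c) \<in> T \<Longrightarrow> x \<in> side T b c \<Longrightarrow> z \<in> side T b c \<Longrightarrow>
    \<exists>b c. (b, c) \<in> T \<and> 3 \<le> degree T b \<and> x \<in> side T b c \<and> z \<notin> side T b c"
proof (induction "card (side T b c)" arbitrary: b c rule: less_induct)
  case less
  have cb: "(c, b) \<in> T" "c \<in> V" using less.prems arcD by blast+
  have V: "x \<in> V" "z \<in> V" using less.prems side_subset_V by blast+
  have "c \<noteq> x" using side_leaf[OF assms(1), of b] less.prems assms(3) by auto
  then obtain e where e: "(c, e) \<in> T" "x \<in> side T c e" using ex_side cb V by blast
  have "c \<noteq> z" using side_leaf[OF assms(2), of b] less.prems assms(3) by auto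
  then obtain f where f: "(c, f) \<in> T" "z \<in> side T c f" using ex_side cb V by blast
  have disj: "side T c b \<inter> side T b c = {}" using side_disjoint[OF cb(1)] by blast
  have eb: "e \<noteq> b" "f \<noteq> b" using e f less.prems disj by auto
  show ?case
  proof (cases "e = f")
    case True
    have "side T c e \<subset> side T b c" using side_nbr_psubset e cb eb by blast
    then have "card (side T c e) < card (side T b c)"
      using finite_side[OF less.prems(1)] by (rule psubset_card_mono[rotated])
    then show ?thesis using less.hyps e f True by blast
  next
    case False
    have "card {b, e, f} \<le> degree T c" by (rule degree_ge_card) (use e f cb in auto)
    then have "3 \<le> degree T c" using False eb by auto
    moreover have "z \<notin> side T c e" using side_unique[OF e(1) f(1) _ f(2)] False by blast
    ultimately show ?thesis using e by blast
  qed
qed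

text \<open>The given branch vertex only starts the descent; the separating one obtained may be
  different.\<close>

lemma branch_separates_leaves:
  assumes "degree T x = 1" "degree T z = 1" "x \<noteq> z" "x \<in> V" "z \<in> V" "b \<in> V" "3 \<le> degree T b"
  obtains b c where "(b, c) \<in> T" "3 \<le> degree T b" "x \<in> side T b c" "z \<notin> side T b c"
proof -
  have "b \<noteq> x" using assms by auto
  then obtain c where c: "(b, c) \<in> T" "x \<in> side T b c" using ex_side assms by blast
  then show ?thesis using that branch_separates_in_side[OF assms(1-3) c] assms(7) by blast
qed

lemma toward_arc:
  assumes "x \<in> V" "y \<in> V" "x \<noteq> y"
  shows "(y, toward T x y) \<in> T" "x \<in> side T y (toward T x y)"
proof -
  have "\<exists>q. (y, q) \<in> T \<and> x \<in> side T y q" using ex_side assms by metis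
  then have "(y, toward T x y) \<in> T \<and> x \<in> side T y (toward T x y)"
    unfolding toward_def by (rule someI_ex)
  then show "(y, toward T x y) \<in> T" "x \<in> side T y (toward T x y)" by auto
qed

text \<open>The path to \<open>x\<close> does not turn back, since otherwise \<open>x\<close> would
  lie on both sides of one edge.\<close>

lemma toward_toward_neq:
  assumes "x \<in> V" "y \<in> V" "x \<noteq> y" "toward T x y \<noteq> x"
  shows "toward T x (toward T x y) \<noteq> y"
proof
  let ?q = "toward T x y"
  assume eq: "toward T x ?q = y"
  have q: "(y, ?q) \<in> T" "x \<in> side T y ?q" using toward_arc assms by auto
  then have "?q \<in> V" using arcD by blast
  then have "x \<in> side T ?q y" using toward_arc[of x ?q] assms eq by auto
  then show False using side_disjoint[OF q(1)] q(2) by blast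
qed

lemma degree_toward_ge_2:
  assumes "x \<in> V" "y \<in> V" "x \<noteq> y" "toward T x y \<noteq> x"
  shows "2 \<le> degree T (toward T x y)"
proof -
  let ?q = "toward T x y"
  have q: "(?q, y) \<in> T" "?q \<in> V" using toward_arc[OF assms(1-3)] arcD by blast+
  have "(?q, toward T x ?q) \<in> T" using toward_arc[of x ?q] assms q by auto
  then have "card {y, toward T x ?q} \<le> degree T ?q" using q by (intro degree_ge_card) auto
  then show ?thesis using toward_toward_neq[OF assms] by auto
qed

text \<open>If \<open>y\<close> and \<open>w\<close> had the same next vertex, that vertex would
  either be the leaf \<open>x\<close> with two neighbours, or have \<open>y\<close>,
  \<open>w\<close> and its own next vertex as three neighbours.\<close>

lemma toward_inj:
  assumes "degree T x = 1" "x \<in> V" "y \<in> V" "x \<noteq> y" "w \<in> V" "x \<noteq> w"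
    and eq: "toward T x y = toward T x w" and "degree T (toward T x y) < 3"
  shows "y = w"
proof (rule ccontr)
  let ?q = "toward T x y"
  assume yw: "y \<noteq> w"
  have q: "(?q, y) \<in> T" "(?q, w) \<in> T" "?q \<in> V"
    using toward_arc[of x y] toward_arc[of x w] assms arcD by metis+
  show False
  proof (cases "?q = x")
    case True
    then show False using leaf_nbr_unique q yw assms(1) by metis
  next
    case False
    have "(?q, toward T x ?q) \<in> T" using toward_arc[of x ?q] assms q False by auto
    then have "card {y, w, toward T x ?q} \<le> degree T ?q" using q by (intro degree_ge_card) auto
    moreover have "toward T x ?q \<noteq> y" "toward T x ?q \<noteq> w"
      using toward_toward_neq[of x y] toward_toward_neq[of x w] assms False by auto
    ultimately show False using yw assms(8) by auto
  qed
qed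

text \<open>For every degree \<open>d >= 1\<close>, \<open>branch_weight d + 2\<close> equals
  \<open>d\<close>, plus 1 if \<open>d = 1\<close>, plus 2 if \<open>d >= 3\<close>. Summing this
  over \<open>V\<close> and inserting \<open>card_T\<close> gives the equation;
  \<open>2 <= card V\<close> excludes degree 0.\<close>

lemma total_branch_degree_counts:
  assumes "2 \<le> card V"
  shows "total_branch_degree V T + 2 = card {v \<in> V. degree T v = 1} + 2 * card {v \<in> V. 3 \<le> degree T v}"
    and "3 * card {v \<in> V. 3 \<le> degree T v} \<le> total_branch_degree V T"
proof -
  have ind: "(\<Sum>v\<in>V. if P v then 1 else 0) = card {v \<in> V. P v}" for P :: "'a \<Rightarrow> bool"
    using finite_V by (simp add: sum.If_cases Int_def conj_commute)
  have pos: "0 < degree T v" if "v \<in> V" for v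
  proof -
    have "\<exists>u\<in>V. u \<noteq> v"
    proof (rule ccontr)
      assume "\<not> ?thesis"
      then have "card V \<le> card {v}" by (intro card_mono) auto
      then show False using assms by simp
    qed
    then show ?thesis using degree_pos that by blast
  qed
  have "(\<Sum>v\<in>V. branch_weight (degree T v) + 2) =
    (\<Sum>v\<in>V. degree T v + (if degree T v = 1 then 1 else 0) + 2 * (if 3 \<le> degree T v then 1 else 0))"
    by (rule sum.cong) (use pos in \<open>force simp: branch_weight_def\<close>)+
  then have "total_branch_degree V T + 2 * card V =
    card T + card {v \<in> V. degree T v = 1} + 2 * card {v \<in> V. 3 \<le> degree T v}"
    by (simp only: sum.distrib sum_degree ind sum_distrib_left[symmetric] total_branch_degree_def[symmetric])
      simp
  then show "total_branch_degree V T + 2 = card {v \<in> V. degree T v = 1} + 2 * card {v \<in> V. 3 \<le> degree T v}"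
    using card_T by linarith
  have "(\<Sum>v\<in>V. 3 * (if 3 \<le> degree T v then 1 else 0)) \<le> total_branch_degree V T"
    unfolding total_branch_degree_def by (rule sum_mono) (simp add: branch_weight_def)
  then show "3 * card {v \<in> V. 3 \<le> degree T v} \<le> total_branch_degree V T"
    by (simp only: ind sum_distrib_left[symmetric])
qed

end

subsection \<open>Trees of minimum total branch degree\<close>

locale minimal_tree = conn_graph V E + T: arc_tree V T
  for V :: "'a set" and E T :: "('a \<times> 'a) set" +
  assumes T_subset: "T \<subseteq> E"
    and minimal: "T' \<subseteq> E \<Longrightarrow> arc_tree V T' \<Longrightarrow> total_branch_degree V T \<le> total_branch_degree V T'"
begin

lemma exchange_subset: "(c, d) \<in> E \<Longrightarrow> exchange T a b c d \<subseteq> E"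
  unfolding exchange_def using T_subset arcD by auto

text \<open>Exchanges that do not raise the total lead to further minimal trees, to which all
  results of this locale apply again.\<close>

lemma exchange_minimal:
  assumes "(a, b) \<in> T" "c \<in> side T a b" "d \<in> side T b a" "(c, d) \<in> E"
    and "total_branch_degree V (exchange T a b c d) \<le> total_branch_degree V T"
  shows "minimal_tree V E (exchange T a b c d)"
proof -
  interpret X: arc_tree V "exchange T a b c d" using T.arc_tree_exchange assms by blast
  show ?thesis
  proof
    fix T' assume "T' \<subseteq> E" "arc_tree V T'"
    then show "total_branch_degree V (exchange T a b c d) \<le> total_branch_degree V T'"
      using minimal[of T'] assms(5) by linarith
  qed (use exchange_subset assms in blast)
qed

lemma exchange_not_less:
  assumes "(a, b) \<in> T" "c \<in> side T a b" "d \<in> side T b a" "(c, d) \<in> E"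
  shows "\<not> total_branch_degree V (exchange T a b c d) < total_branch_degree V T"
  using minimal[OF exchange_subset] T.arc_tree_exchange assms by (simp add: leD)

text \<open>Otherwise an edge at a branch vertex on the path between the leaves could be traded for
  \<open>xz\<close>: the leaves reach degree at most 2 and the branch vertex loses weight. The
  vertex \<open>b0\<close> guarantees that some branch vertex exists.\<close>

lemma leaves_nonadjacent:
  assumes "degree T x = 1" "degree T z = 1" "x \<noteq> z" "x \<in> V" "z \<in> V" "b0 \<in> V" "3 \<le> degree T b0"
  shows "(x, z) \<notin> E"
proof
  assume xz: "(x, z) \<in> E"
  obtain b c where bc: "(b, c) \<in> T" "3 \<le> degree T b" "x \<in> side T b c" "z \<notin> side T b c"
    using T.branch_separates_leaves assms by blast
  have z: "z \<in> side T c b" using T.side_compl[OF bc(1)] bc(4) assms(5) by blast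
  let ?X = "exchange T b c x z"
  have deg: "degree ?X v + (if v = b \<or> v = c then 1 else 0) = degree T v + (if v = x \<or> v = z then 1 else 0)" for v
    using T.degree_exchange[OF bc(1,3) z] .
  have "total_branch_degree V ?X < total_branch_degree V T"
    unfolding total_branch_degree_def
  proof (rule sum_strict_mono_ex1[OF finite_V])
    show "\<forall>v\<in>V. branch_weight (degree ?X v) \<le> branch_weight (degree T v)"
    proof
      fix v
      show "branch_weight (degree ?X v) \<le> branch_weight (degree T v)"
        using deg[of v] assms(1,2) by (auto simp: branch_weight_def split: if_splits)
    qed
    have "b \<in> V" "b \<noteq> x" "b \<noteq> z" using T.arcD bc assms(1,2) by auto
    moreover have "branch_weight (degree ?X b) < branch_weight (degree T b)"
      using deg[of b] bc(2) \<open>b \<noteq> x\<close> \<open>b \<noteq> z\<close> by (auto simp: branch_weight_def)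
    ultimately show "\<exists>v\<in>V. branch_weight (degree ?X v) < branch_weight (degree T v)" by blast
  qed
  then show False using exchange_not_less bc z xz by blast
qed

text \<open>Trading \<open>yq\<close> for \<open>xy\<close> keeps the degree of \<open>y\<close> and
  raises the leaf \<open>x\<close> to degree 2, so only the weight of \<open>q\<close> can change.
  It would drop if \<open>q\<close> were a branch vertex, against minimality.\<close>

lemma toward_exchange:
  assumes "degree T x = 1" "(x, y) \<in> E"
  defines "q \<equiv> toward T x y"
  shows "degree T q < 3"
    and "q \<noteq> x \<Longrightarrow> minimal_tree V E (exchange T y q x y)"
    and "q \<noteq> x \<Longrightarrow> degree (exchange T y q x y) v + (if v = q then 1 else 0)
      = degree T v + (if v = x then 1 else 0)"
proof -
  have V: "x \<in> V" "y \<in> V" "x \<noteq> y" using arcD assms(2) by auto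
  have q: "(y, q) \<in> T" "x \<in> side T y q" using T.toward_arc V unfolding q_def by auto
  have qy: "q \<noteq> y" "q \<in> V" using T.arcD q by auto
  have y: "y \<in> side T q y" by (rule side_self)
  let ?X = "exchange T y q x y"
  have deg: "degree ?X v + (if v = q then 1 else 0) = degree T v + (if v = x then 1 else 0)"
    if "q \<noteq> x" for v
    using T.degree_exchange[OF q y, of v] qy V that by (auto split: if_splits)
  then show "q \<noteq> x \<Longrightarrow> degree ?X v + (if v = q then 1 else 0) = degree T v + (if v = x then 1 else 0)" .
  have le: "branch_weight (degree ?X v) \<le> branch_weight (degree T v)" if "q \<noteq> x" for v
    using deg[OF that, of v] assms(1) that by (auto simp: branch_weight_def split: if_splits)
  then show "q \<noteq> x \<Longrightarrow> minimal_tree V E ?X"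
    using exchange_minimal[OF q y assms(2)] unfolding total_branch_degree_def by (simp add: sum_mono)
  show "degree T q < 3"
  proof (rule ccontr)
    assume br: "\<not> degree T q < 3"
    then have qx: "q \<noteq> x" using assms(1) by auto
    have "total_branch_degree V ?X < total_branch_degree V T"
      unfolding total_branch_degree_def
    proof (rule sum_strict_mono_ex1[OF finite_V])
      show "\<forall>v\<in>V. branch_weight (degree ?X v) \<le> branch_weight (degree T v)" using le qx by blast
      have "branch_weight (degree ?X q) < branch_weight (degree T q)"
        using deg[OF qx, of q] br qx by (auto simp: branch_weight_def)
      then show "\<exists>v\<in>V. branch_weight (degree ?X v) < branch_weight (degree T v)" using qy by blast
    qed
    then show False using exchange_not_less q y assms(2) by blast
  qed
qed

text \<open>After the exchange of \<open>toward_exchange\<close> the vertex \<open>?q\<close> is a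
  leaf of another minimal tree in which \<open>z\<close> is still a leaf, so
  \<open>leaves_nonadjacent\<close> applies there.\<close>

lemma toward_nonadjacent:
  assumes "degree T x = 1" "degree T z = 1" "x \<noteq> z" "z \<in> V" "b0 \<in> V" "3 \<le> degree T b0"
    and "(x, y) \<in> E"
  shows "(z, toward T x y) \<notin> E"
proof
  let ?q = "toward T x y"
  assume zq: "(z, ?q) \<in> E"
  have V: "x \<in> V" "y \<in> V" "x \<noteq> y" using arcD assms(7) by auto
  show False
  proof (cases "?q = x")
    case True
    then show False using leaves_nonadjacent[of z x] zq assms V by auto
  next
    case False
    let ?X = "exchange T y ?q x y"
    interpret X: minimal_tree V E ?X using toward_exchange(2) assms False by blast
    have deg: "degree ?X v + (if v = ?q then 1 else 0) = degree T v + (if v = x then 1 else 0)" for v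
      using toward_exchange(3) assms False by blast
    have q2: "degree T ?q = 2"
      using T.degree_toward_ge_2[OF V False] toward_exchange(1)[OF assms(1,7)] by linarith
    have "degree ?X ?q = 1" using deg[of ?q] q2 False by simp
    moreover have zq': "z \<noteq> ?q" using q2 assms(2) by auto
    moreover have "degree ?X z = 1" using deg[of z] zq' assms(2,3) by auto
    moreover have "3 \<le> degree ?X b0" using deg[of b0] q2 assms(6) by (auto split: if_splits)
    ultimately show False using X.leaves_nonadjacent[of z ?q b0] zq assms arcD by auto
  qed
qed

text \<open>Since \<open>min_side\<close> ranges over all minimal trees, it also refutes an exchange
  that keeps the total branch degree but shrinks the side.\<close>

lemma ex_leaf_with_single_branch_nbr:
  assumes b: "3 \<le> degree T b" and cb: "(c, b) \<in> T"
    and min_side: "\<And>T' b' c'. minimal_tree V E T' \<Longrightarrow> 3 \<le> degree T' b' \<Longrightarrow> (c', b') \<in> T' \<Longrightarrow>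
      card (side T c b) \<le> card (side T' c' b')"
  obtains z where "z \<in> V" "degree T z = 1" "\<And>y. (z, y) \<in> E \<Longrightarrow> 3 \<le> degree T y \<Longrightarrow> y = b"
proof -
  have bc: "(b, c) \<in> T" "b \<in> V" "b \<noteq> c" using T.arcD cb by auto
  have fin: "finite (side T c b)" using T.finite_side cb by blast
  have self: "minimal_tree V E T" by (rule minimal_tree_axioms)
  \<comment> \<open>At another branch vertex \<open>w\<close> in the side, the edge leading toward
    \<open>b\<close> would have a smaller side containing \<open>w\<close>.\<close>
  have only_b: "w = b" if "w \<in> side T c b" "3 \<le> degree T w" for w
  proof (rule ccontr)
    assume wb: "w \<noteq> b"
    have "w \<in> V" using that T.side_subset_V cb by blast
    then obtain q where q: "(w, q) \<in> T" "b \<in> side T w q" using T.ex_side bc wb by blast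
    have qw: "(q, w) \<in> T" using q T.arcD by blast
    have nb: "b \<notin> side T q w" using T.side_disjoint[OF q(1)] q(2) by blast
    then have "side T q w \<subseteq> side T c b" using T.side_mono that by blast
    then have "side T q w \<subset> side T c b" using nb side_self[of b T c] by blast
    then have "card (side T q w) < card (side T c b)" by (rule psubset_card_mono[OF fin])
    then show False using min_side[OF self that(2) qw] by simp
  qed
  obtain p where p: "(b, p) \<in> T" "p \<noteq> c" using T.ex_other_nbr[OF bc(1)] b by auto
  have pb: "(p, b) \<in> T" "p \<noteq> b" using T.arcD p by auto
  have sub: "side T b p \<subset> side T c b" using T.side_nbr_psubset p bc by blast
  have nbp: "b \<notin> side T b p" using T.side_notin p by blast
  obtain z where z: "z \<in> side T b p" "degree T z = 1" using T.ex_leaf_in_side p by blast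
  have zV: "z \<in> V" using z T.side_subset_V p by blast
  have "y = b" if zy: "(z, y) \<in> E" and y: "3 \<le> degree T y" for y
  proof (rule ccontr)
    assume yb: "y \<noteq> b"
    have yV: "y \<in> V" using zy arcD by blast
    have yn: "y \<notin> side T c b" using only_b y yb by blast
    have y': "y \<in> side T p b" using T.side_compl[OF p(1)] yn sub yV by blast
    have pdeg: "degree T p < 3" using only_b[of p] side_self[of p T b] sub pb by fastforce
    have neq: "y \<noteq> p" "y \<noteq> z" "z \<noteq> b" using y pdeg z b by auto
    let ?X = "exchange T b p z y"
    have deg: "degree ?X v + (if v = b \<or> v = p then 1 else 0) = degree T v + (if v = z \<or> v = y then 1 else 0)" for v
      using T.degree_exchange[OF p(1) z(1) y'] .
    \<comment> \<open>The vertices \<open>b\<close> and \<open>y\<close> are split off because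
      \<open>y\<close> gains one in weight, which the loss at \<open>b\<close> has to
      compensate.\<close>
    have split: "total_branch_degree V R = (\<Sum>v\<in>V - {b, y}. branch_weight (degree R v))
        + branch_weight (degree R b) + branch_weight (degree R y)" for R
    proof -
      have "V = insert b (insert y (V - {b, y}))" using bc yV by blast
      then have "total_branch_degree V R
          = (\<Sum>v\<in>insert b (insert y (V - {b, y})). branch_weight (degree R v))"
        unfolding total_branch_degree_def by simp
      then show ?thesis using finite_V yb by simp
    qed
    have rest: "(\<Sum>v\<in>V - {b, y}. branch_weight (degree ?X v)) \<le> (\<Sum>v\<in>V - {b, y}. branch_weight (degree T v))"
    proof (rule sum_mono)
      fix v assume "v \<in> V - {b, y}"
      then show "branch_weight (degree ?X v) \<le> branch_weight (degree T v)"
        using deg[of v] z(2) by (auto simp: branch_weight_def split: if_splits)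
    qed
    have degs: "degree ?X y = degree T y + 1" "degree ?X b + 1 = degree T b"
      using deg[of y] deg[of b] neq yb by auto
    have le: "total_branch_degree V ?X \<le> total_branch_degree V T"
      using split[of ?X] split[of T] rest degs b y by (auto simp: branch_weight_def split: if_splits)
    \<comment> \<open>At degree 3, \<open>b\<close> would lose its whole weight 3 while
      \<open>y\<close> gains only 1. With degree at least 4, \<open>b\<close> remains a branch
      vertex of \<open>?X\<close>.\<close>
    have four: "4 \<le> degree T b"
    proof (rule ccontr)
      assume "\<not> 4 \<le> degree T b"
      then have "total_branch_degree V ?X < total_branch_degree V T"
        using split[of ?X] split[of T] rest degs b y by (auto simp: branch_weight_def split: if_splits)
      then show False using exchange_not_less p z y' zy by blast
    qed
    have X: "minimal_tree V E ?X" using exchange_minimal p z y' zy le by blast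
    have cX: "(c, b) \<in> ?X" unfolding exchange_def using cb p bc by auto
    \<comment> \<open>The new edge joins \<open>z\<close>, inside the part cut off, to
      \<open>y\<close>, outside the old side, so neither end is reached from \<open>b\<close>
      without crossing \<open>cb\<close>.\<close>
    have "side ?X c b \<subseteq> side T c b - side T b p"
    proof (rule side_subsetI)
      show "b \<in> side T c b - side T b p" using nbp side_self[of b T c] by blast
      fix u v assume u: "u \<in> side T c b - side T b p"
        and uv: "(u, v) \<in> ?X" "(u, v) \<noteq> (c, b)" "(u, v) \<noteq> (b, c)"
      have "u \<noteq> z" "u \<noteq> y" using u z yn by auto
      then have uvT: "(u, v) \<in> T" "(u, v) \<noteq> (b, p)" "(u, v) \<noteq> (p, b)"
        using uv(1) unfolding exchange_def by auto
      have "v \<in> side T c b" using side_step[of u T c b v] u uvT uv by blast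
      moreover have "v \<notin> side T b p"
        using side_step[of v T b p u] u uvT T.arcD by auto
      ultimately show "v \<in> side T c b - side T b p" by blast
    qed
    then have "side ?X c b \<subset> side T c b" using z sub by blast
    then have "card (side ?X c b) < card (side T c b)" by (rule psubset_card_mono[OF fin])
    moreover have "3 \<le> degree ?X b" using degs four by linarith
    ultimately show False using min_side[OF X _ cX] by fastforce
  qed
  then show ?thesis using that z zV by blast
qed

text \<open>Four disjoint subsets of \<open>V\<close> are counted: the shifted neighbourhood
  \<open>?P\<close> of \<open>x\<close>, the neighbourhood of \<open>z\<close>, the leaves without
  \<open>x\<close>, and the branch vertices without \<open>b\<close>. The leaf \<open>x\<close> is
  left out because its tree neighbour is sent to it, and \<open>b\<close> because it may be adjacent
  to \<open>z\<close>.\<close>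

lemma degree_sum_le:
  assumes b: "b \<in> V" "3 \<le> degree T b"
    and z: "z \<in> V" "degree T z = 1" "\<And>y. (z, y) \<in> E \<Longrightarrow> 3 \<le> degree T y \<Longrightarrow> y = b"
    and x: "x \<in> V" "degree T x = 1" "x \<noteq> z"
  shows "degree E x + degree E z + card {v \<in> V. degree T v = 1} + card {v \<in> V. 3 \<le> degree T v}
    \<le> card V + 2"
proof -
  let ?N = "\<lambda>v. {u. (v, u) \<in> E}"
  let ?L = "{v \<in> V. degree T v = 1}" and ?B = "{v \<in> V. 3 \<le> degree T v}"
  let ?P = "toward T x ` ?N x"
  have NV: "v \<in> V \<and> x \<noteq> v" if "v \<in> ?N x" for v using that arcD by blast
  have "inj_on (toward T x) (?N x)"
    by (rule inj_onI) (use T.toward_inj x NV toward_exchange(1) in blast)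
  then have cP: "card ?P = degree E x" by (simp add: card_image degree_def)
  have PV: "q \<in> V \<and> q \<notin> ?L - {x} \<and> q \<notin> ?B \<and> q \<notin> ?N z" if qP: "q \<in> ?P" for q
  proof -
    obtain y where y: "(x, y) \<in> E" "q = toward T x y" using qP by blast
    have yV: "y \<in> V" "x \<noteq> y" using NV y by auto
    have "q \<in> V" using T.toward_arc[of x y] T.arcD yV x y by blast
    moreover have "q \<notin> ?L - {x}" using T.degree_toward_ge_2[of x y] yV x y by fastforce
    moreover have "q \<notin> ?B" using toward_exchange(1)[OF x(2) y(1)] y by simp
    moreover have "q \<notin> ?N z" using toward_nonadjacent[OF x(2) z(2) x(3) z(1) b y(1)] y by simp
    ultimately show ?thesis by blast
  qed
  have NzV: "q \<in> V \<and> q \<notin> ?L \<and> q \<notin> ?B - {b}" if "q \<in> ?N z" for q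
  proof -
    have q: "(z, q) \<in> E" "q \<in> V" "z \<noteq> q" using that arcD by auto
    then have "q \<notin> ?L" using leaves_nonadjacent[of z q b] z b by auto
    then show ?thesis using q z(3) by auto
  qed
  have fin: "finite ?P" "finite (?N z)" using finite_nbrs by auto
  have "card (?P \<union> ?N z \<union> (?L - {x}) \<union> (?B - {b})) \<le> card V"
    by (rule card_mono[OF finite_V]) (use PV NzV in blast)
  moreover have "card (?P \<union> ?N z \<union> (?L - {x}) \<union> (?B - {b}))
      = card ?P + card (?N z) + card (?L - {x}) + card (?B - {b})"
  proof -
    have "?P \<inter> ?N z = {}" "(?P \<union> ?N z) \<inter> (?L - {x}) = {}"
      "(?P \<union> ?N z \<union> (?L - {x})) \<inter> (?B - {b}) = {}"
      using PV NzV by auto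
    then show ?thesis using fin finite_V by (simp add: card_Un_disjoint)
  qed
  moreover have "card (?L - {x}) + 1 = card ?L" "card (?B - {b}) + 1 = card ?B"
    using card_Suc_Diff1[of ?L x] card_Suc_Diff1[of ?B b] x b finite_V by auto
  moreover have "card (?N z) = degree E z" by (simp add: degree_def)
  ultimately show ?thesis using cP by linarith
qed

end

section \<open>The extremal choice and the resulting degree bound\<close>

context conn_graph
begin

lemma ex_minimal_tree: "\<exists>T. minimal_tree V E T"
proof -
  define P where "P T \<longleftrightarrow> T \<subseteq> E \<and> arc_tree V T" for T
  define T where "T = arg_min (total_branch_degree V) P"
  obtain T0 where "P T0" using ex_spanning_arc_tree P_def by blast
  then have T: "P T" "\<And>T'. P T' \<Longrightarrow> total_branch_degree V T \<le> total_branch_degree V T'"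
    unfolding T_def by (auto intro: arg_min_natI arg_min_nat_le)
  interpret T: arc_tree V T using T(1) P_def by blast
  have "minimal_tree V E T" by unfold_locales (use T P_def in auto)
  then show ?thesis ..
qed

text \<open>The second case provides the nonadjacent pair to which the hypothesis on
  \<open>sigma2\<close> will be applied.\<close>

lemma ex_tree_total_branch_degree:
  obtains T where "T \<subseteq> E" "arc_tree V T" "total_branch_degree V T = 0"
  | T x z where "T \<subseteq> E" "arc_tree V T" "x \<in> V" "z \<in> V" "x \<noteq> z" "(x, z) \<notin> E"
    "2 * total_branch_degree V T + 3 * (degree E x + degree E z) \<le> 3 * card V"
proof (cases "\<exists>T. minimal_tree V E T \<and> (\<forall>b\<in>V. degree T b < 3)")
  case True
  then obtain T where T: "minimal_tree V E T" "\<forall>b\<in>V. degree T b < 3" by blast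
  interpret T: minimal_tree V E T by fact
  have "total_branch_degree V T = 0"
    using T(2) unfolding total_branch_degree_def
    by (intro sum.neutral) (auto simp: branch_weight_def)
  then show ?thesis using that(1) T.T_subset T.T.arc_tree_axioms by blast
next
  case False
  \<comment> \<open>The tree varies together with the edge, as \<open>min_side\<close>
    requires.\<close>
  define P where "P = (\<lambda>(T, c, b). minimal_tree V E T \<and> 3 \<le> degree T b \<and> (c, b) \<in> T)"
  define m where "m = arg_min (\<lambda>(T, c, b). card (side T c b)) P"
  obtain T0 where T0: "minimal_tree V E T0" using ex_minimal_tree by blast
  then obtain b0 where b0: "b0 \<in> V" "3 \<le> degree T0 b0" using False by (meson not_less)
  interpret T0: minimal_tree V E T0 by fact
  have "{u. (b0, u) \<in> T0} \<noteq> {}" using b0 by (metis card.empty degree_def not_numeral_le_zero)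
  then obtain c0 where "(c0, b0) \<in> T0" using T0.T.arcD by blast
  then have "P (T0, c0, b0)" using T0 b0 by (simp add: P_def)
  then have m: "P m" unfolding m_def by (rule arg_min_natI)
  obtain T c b where mT: "m = (T, c, b)" by (cases m)
  have T: "minimal_tree V E T" "3 \<le> degree T b" "(c, b) \<in> T" using m mT by (auto simp: P_def)
  interpret T: minimal_tree V E T by fact
  have bV: "b \<in> V" "c \<in> V" "c \<noteq> b" using T.T.arcD T by auto
  have "card (side T c b) \<le> card (side T' c' b')"
    if "minimal_tree V E T'" "3 \<le> degree T' b'" "(c', b') \<in> T'" for T' b' c'
    using arg_min_nat_le[of P "(T', c', b')" "\<lambda>(T, c, b). card (side T c b)"] that mT
    by (simp add: P_def m_def)
  then obtain z where z: "z \<in> V" "degree T z = 1" "\<And>y. (z, y) \<in> E \<Longrightarrow> 3 \<le> degree T y \<Longrightarrow> y = b"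
    using T.ex_leaf_with_single_branch_nbr[OF T(2,3)] by metis
  let ?L = "{v \<in> V. degree T v = 1}" and ?B = "{v \<in> V. 3 \<le> degree T v}"
  have "card {c, b} \<le> card V" using bV finite_V by (intro card_mono) auto
  then have V2: "2 \<le> card V" using bV by simp
  have counts: "total_branch_degree V T + 2 = card ?L + 2 * card ?B" "3 * card ?B \<le> total_branch_degree V T"
    using T.T.total_branch_degree_counts[OF V2] .
  \<comment> \<open>The two facts in \<open>counts\<close> give
    \<open>card ?L >= card ?B + 2\<close>, hence a second leaf.\<close>
  have "\<not> ?L \<subseteq> {z}"
  proof
    assume "?L \<subseteq> {z}"
    then have "card ?L \<le> card {z}" by (intro card_mono) auto
    then show False using counts by simp
  qed
  then obtain x where x: "x \<in> V" "degree T x = 1" "x \<noteq> z" by blast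
  have "degree E x + degree E z + total_branch_degree V T \<le> card V + card ?B"
    using T.degree_sum_le[OF bV(1) T(2) z x] counts(1) by linarith
  \<comment> \<open>Triple the previous inequality and bound \<open>3 * card ?B\<close> by the total
    branch degree.\<close>
  then have "2 * total_branch_degree V T + 3 * (degree E x + degree E z) \<le> 3 * card V"
    using counts(2) unfolding distrib_left by linarith
  moreover have "(x, z) \<notin> E" using T.leaves_nonadjacent x z bV T by blast
  ultimately show ?thesis using that(2) T.T_subset T.T.arc_tree_axioms x z by blast
qed

end

subsection \<open>Transfer to digraphs\<close>

lemma pcas_last: "pcas u p v \<Longrightarrow> v \<in> set (pawalk_verts u p)"
  by (induction p arbitrary: u) auto

lemma pcas_rtrancl:
  "pcas u p v \<Longrightarrow> set p \<subseteq> R \<Longrightarrow> (u, v) \<in> R\<^sup>*"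
  by (induction p arbitrary: u) (auto intro: converse_rtrancl_into_rtrancl)

lemma arc_in_pawalk_verts:
  "pcas u p v \<Longrightarrow> (a, b) \<in> set p \<Longrightarrow> a \<in> set (pawalk_verts u p) \<and> b \<in> set (pawalk_verts u p)"
proof (induction p arbitrary: u)
  case (Cons e p)
  then show ?case by (cases p) auto
qed simp

text \<open>After its first arc \<open>uv\<close>, a cycle of length at least 3 returns from
  \<open>v\<close> to \<open>u\<close> without using the edge \<open>uv\<close>, contradicting
  \<open>bridge\<close>.\<close>

lemma (in arc_tree) no_long_cycle:
  assumes "set p \<subseteq> T" "pcas u p u" "distinct (tl (pawalk_verts u p))"
  shows "length p < 3"
proof (rule ccontr)
  assume "\<not> length p < 3"
  then obtain e f g q where p: "p = e # f # g # q"
    by (metis One_nat_def Suc_1 length_Cons less_Suc_eq list.exhaust list.size(3) numeral_3_eq_3 zero_less_Suc)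
  obtain v w where e: "e = (u, v)" and f: "f = (v, w)" and fst_g: "fst g = w"
    using assms(2) p by (cases e, cases f) auto
  let ?r = "g # q"
  have r: "pcas w ?r u" using assms(2) p f by simp
  have dist: "v \<notin> set (pawalk_verts w ?r)" "distinct (pawalk_verts w ?r)"
    using assms(3) p e f fst_g by auto
  have uv: "(u, v) \<in> T" using assms(1) p e by auto
  have "w \<noteq> u"
    using dist(2) pcas_last[of "snd g" q u] r fst_g by auto
  then have "(v, w) \<in> T - {(u, v), (v, u)}" using assms(1) p f arcD uv by auto
  \<comment> \<open>By distinctness \<open>v\<close> does not occur again, so no later arc touches
    the first edge.\<close>
  moreover have "set ?r \<subseteq> T - {(u, v), (v, u)}"
    using arc_in_pawalk_verts[OF r] dist(1) assms(1) p by fastforce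
  then have "(w, u) \<in> (T - {(u, v), (v, u)})\<^sup>*" by (rule pcas_rtrancl[OF r])
  ultimately have "(v, u) \<in> (T - {(u, v), (v, u)})\<^sup>*" by (rule converse_rtrancl_into_rtrancl)
  then show False using bridge[of v u] uv arcD by (auto simp: insert_commute)
qed

lemma out_degree_eq_degree: "out_degree (with_proj G) v = degree (parcs G) v"
proof -
  have "out_arcs (with_proj G) v = Pair v ` {u. (v, u) \<in> parcs G}" by (auto simp: out_arcs_def)
  then show ?thesis by (simp add: out_degree_def degree_def card_image inj_on_def)
qed

lemma conn_graph_if_connected:
  assumes "pair_graph G" "Digraph_Component.connected G"
  shows "conn_graph (pverts G) (parcs G)"
proof -
  interpret pair_graph G by fact
  have "strongly_connected G"
    using symmetric_connected_imp_strongly_connected pair_sym_arcs assms(2) by blast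
  then have sc: "pverts G \<noteq> {}"
    "\<And>u v. u \<in> pverts G \<Longrightarrow> v \<in> pverts G \<Longrightarrow> (u, v) \<in> rtrancl_on (pverts G) (parcs G)"
    by (auto simp: strongly_connected_def reachable_def)
  show ?thesis
  proof
    show "sym (parcs G)" using pair_sym_arcs by (simp add: symmetric_def)
    show "irrefl (parcs G)" using pair_no_loops by (force simp: irrefl_def)
    show "parcs G \<subseteq> pverts G \<times> pverts G" using in_arcsD1 in_arcsD2 by auto
    show "(u, v) \<in> (parcs G)\<^sup>*" if "u \<in> pverts G" "v \<in> pverts G" for u v
      using sc(2)[OF that] by (rule rtrancl_on_rtranclI)
  qed (use sc pair_finite_verts in auto)
qed

lemma undirected_spanning_tree_if_arc_tree:
  assumes "pair_graph G" "arc_tree (pverts G) T" "T \<subseteq> parcs G"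
  shows "undirected_spanning_tree \<lparr>pverts = pverts G, parcs = T\<rparr> G"
proof -
  let ?H = "\<lparr>pverts = pverts G, parcs = T\<rparr>"
  interpret G: pair_graph G by fact
  interpret T: arc_tree "pverts G" T by fact
  interpret H: pair_graph ?H
    by unfold_locales (use T.finite_V T.finite_E T.arcD T.sym_E in \<open>simp_all add: symmetric_def split_paired_all\<close>)
  have reach: "(u, v) \<in> rtrancl_on (pverts G) T" if "u \<in> pverts G" "v \<in> pverts G" for u v
    using T.connected_E[OF that] that by (rule rtrancl_consistent_rtrancl_on) (use T.arcD in blast)
  have "Digraph_Component.connected ?H"
    unfolding connected_conv using T.V_nonempty reach
      rtrancl_on_mono[of T "T\<^sup>s" "pverts G" "pverts G"] by (simp add: symcl_def)
  moreover have "\<not> (pre_digraph.cycle ?H p \<and> 3 \<le> length p)" for p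
    using T.no_long_cycle[of p] unfolding H.cycle_def H.awalk_def by fastforce
  moreover have "spanning ?H G"
    unfolding spanning_def subgraph_def compatible_def
    using assms(3) G.wf_digraph_axioms H.wf_digraph_axioms by simp
  ultimately show ?thesis
    unfolding undirected_spanning_tree_def undirected_tree_def using H.pair_graph_axioms by blast
qed

lemma sum_branch_vertices:
  fixes T :: "'a pair_pre_digraph"
  assumes "finite (pverts T)"
  shows "(\<Sum>v\<in>branch_vertices T. out_degree T v) = total_branch_degree (pverts T) (parcs T)"
  unfolding branch_vertices_def total_branch_degree_def branch_weight_def out_degree_eq_degree
  using assms by (simp add: sum.inter_filter)

theorem theorem3:
  fixes G :: "'a pair_pre_digraph" and n k :: nat
  assumes "pair_graph G"
    and "Digraph_Component.connected G"
    and "card (pverts G) = n"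
    and "0 < k"
    and "sigma2 G \<ge> ereal (real n - real k + 1)"
  shows "\<exists>T. undirected_spanning_tree T G \<and>
    real (\<Sum>v\<in>branch_vertices T. out_degree T v) \<le> 3 / 2 * (real k - 1)"
proof -
  interpret conn_graph "pverts G" "parcs G" using conn_graph_if_connected assms by blast
  obtain T where T: "T \<subseteq> parcs G" "arc_tree (pverts G) T"
    and le: "real (total_branch_degree (pverts G) T) \<le> 3 / 2 * (real k - 1)"
  proof (rule ex_tree_total_branch_degree)
    fix T assume "T \<subseteq> parcs G" "arc_tree (pverts G) T" "total_branch_degree (pverts G) T = 0"
    \<comment> \<open>Positivity of \<open>k\<close> makes the right-hand side nonnegative.\<close>
    then show thesis using that assms(4) by simp
  next
    fix T x z
    assume *: "T \<subseteq> parcs G" "arc_tree (pverts G) T" "x \<in> pverts G" "z \<in> pverts G" "x \<noteq> z"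
      "(x, z) \<notin> parcs G"
      and sum: "2 * total_branch_degree (pverts G) T + 3 * (degree (parcs G) x + degree (parcs G) z)
        \<le> 3 * card (pverts G)"
    have "sigma2 G \<le> ereal (real (out_degree G x + out_degree G z))"
      unfolding sigma2_def by (rule Inf_lower) (use * in blast)
    then have "ereal (real n - real k + 1) \<le> ereal (real (out_degree G x + out_degree G z))"
      using assms(5) by (rule order_trans[rotated])
    then have "real n - real k + 1 \<le> real (degree (parcs G) x + degree (parcs G) z)"
      by (simp add: out_degree_eq_degree)
    moreover have "2 * real (total_branch_degree (pverts G) T)
        + 3 * real (degree (parcs G) x + degree (parcs G) z) \<le> 3 * real n"
      using sum assms(3) by linarith
    ultimately have "real (total_branch_degree (pverts G) T) \<le> 3 / 2 * (real k - 1)" by argo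
    then show thesis using that * by blast
  qed
  let ?H = "\<lparr>pverts = pverts G, parcs = T\<rparr>"
  have "undirected_spanning_tree ?H G"
    using undirected_spanning_tree_if_arc_tree assms(1) T by blast
  moreover have "(\<Sum>v\<in>branch_vertices ?H. out_degree ?H v) = total_branch_degree (pverts G) T"
    using sum_branch_vertices[of ?H] finite_V by simp
  ultimately show ?thesis using le by metis
qed

end
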